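(* Let $W$ be an $\omega$-Stone space. (i) If $P$ is a poset and $\mathscr{X}$ is a trim $P$-partition of $W$, then $\mathscr{X}$ is the clean interior of its completion: $\mathscr{X}=(\overline{\mathscr{X}})^o$. (ii) If $Q$ is a poset, $\mathscr{Y}$ is a complete semi-trim $Q$-partition of $W$, and $Q$ is chain-unique over $\widehat Q$, then $\mathscr{Y}$ refines $\overline{\mathscr{Y}^o}$ (i.e. each element of $\mathscr{Y}$ is contained in some element of $\overline{\mathscr{Y}^o}$).
   Context: Let $(P,\le)$ be a poset and $W$ a Stone space. A $P$-partition of $W$ is a family $\mathscr{X}=\{X_p\mid p\in P\}$ of pairwise disjoint non-empty subsets of $W$; it is complete if their union is $W$. For $Y\subseteq W$, $T(Y)=\{p: Y\cap X_p\neq\emptyset\}$. A compact open set $A$ is $p$-trim ($t(A)=p$) if $T(A)=\{q:q\ge p\}$, trim if $p$-trim for some $p$. $\widehat P=\{p\in P: W$ contains a $p$-trim set$\}$. $\mathscr{X}$ is semi-trim if: every point of $W$ has a neighbourhood base of trim sets; if $A$ is open and $p\in T(A)\cap\widehat P$ then $A$ contains a $p$-trim subset; if $x\in X_p$ then $p=\sup_P\{t(A): A\text{ trim}, x\in A\}$; and for each $p$, every point with a neighbourhood base of $p$-trim sets lies in $X_p$. A point $w\in X_p$ is clean if it has a $p$-trim neighbourhood; a trim partition is a semi-trim one all of whose points are clean. An $\omega$-Stone space is the Stone space of a countable Boolean ring. The clean interior of a semi-trim $P$-partition $\mathscr{X}$ is the $\widehat P$-partition $\mathscr{X}^o=\{Z_q\mid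 q\in\widehat P\}$ with $Z_q$ the set of clean points of $X_q$. $\overline P$ denotes the chain completion of $P$ in the sense of Markowsky (Chain-complete posets and directed sets with applications, Algebra Universalis 1976): it contains $P$ as a subposet, every ascending sequence in $\overline P$ has a supremum, every element is the supremum of an ascending sequence from $P$, and suprema in $P$ of ascending sequences in $P$ remain suprema in $\overline P$. For countable $Q\subseteq P$, $\overline{P:Q}$ is the subposet of $\overline P$ consisting of $P$ together with the suprema in $\overline P$ of ascending sequences in $Q$; for a semi-trim $P$-partition write $\overrightarrow P=\overline{P:\widehat P}$. The completion of a semi-trim $P$-partition $\mathscr{X}$ of an $\omega$-Stone space $W$ is the $\overrightarrow P$-partition $\overline{\mathscr{X}}=\{Y_r\mid r\in\overrightarrow P\}$ where $Y_r=\{w\in W: \sup_{\overrightarrow P}\{t(B): B\text{ trim}, w\in B\}=r\}$ (it is a complete semi-trim partition of $W$). For posets $P\subseteq Q$, $Q$ is chain-unique over $P$ if whenever an ascending sequence $p_1\le p_2\le\cdots$ in $P$ has supremum $q$ in $Q$ and $r\in P$ with $r<q$, then $r\le p_n$ for some $n$.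
   Formalization: In (i) the completion of the trim partition is assumed to be semi-trim, the condition under which its clean interior is defined; the background claim that this always holds fails for some posets, and (i) then fails. Part (ii) is unchanged. *)

theory Defs
  imports "HOL-Analysis.Analysis" "HOL-Library.Lub_Glb"
begin

section \<open>Stone spaces of Boolean rings\<close>

(* Boolean rings need not have an identity (the class ring is non-unital), so their Stone
   spaces are locally compact but not necessarily compact. *)
class boolean_ring = ring +
  assumes mult_idem: "x * x = x"

definition prime_ideal :: "'r::boolean_ring set \<Rightarrow> bool" where
  "prime_ideal I \<longleftrightarrow>
     I \<noteq> UNIV \<and> 0 \<in> I \<and> (\<forall>a\<in>I. \<forall>b\<in>I. a + b \<in> I) \<and> (\<forall>a\<in>I. \<forall>r. r * a \<in> I \<and> a * r \<in> I) \<and>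
     (\<forall>a b. a * b \<in> I \<longrightarrow> a \<in> I \<or> b \<in> I)"

definition stone_space :: "'r::boolean_ring set topology" where
  "stone_space = topology_generated_by {{I. prime_ideal I \<and> a \<notin> I} | a. True}"

section \<open>Trim partitions\<close>

(* A poset is a set P of elements of a type of class order, with the induced order; this
   makes sub-posets such as trim_hat below posets again. A P-partition is a family X of
   which only the members X p with p in P matter. Suprema in a poset P are given by isLub P. *)

definition poset_partition :: "'w topology \<Rightarrow> 'p::order set \<Rightarrow> ('p \<Rightarrow> 'w set) \<Rightarrow> bool" where
  "poset_partition W P X \<longleftrightarrow>
     (\<forall>p\<in>P. X p \<noteq> {} \<and> X p \<subseteq> topspace W) \<and> disjoint_family_on X P"

definition complete_partition :: "'w topology \<Rightarrow> 'p::order set \<Rightarrow> ('p \<Rightarrow> 'w set) \<Rightarrow> bool" where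
  "complete_partition W P X \<longleftrightarrow> poset_partition W P X \<and> (\<Union>p\<in>P. X p) = topspace W"

definition meets :: "'p::order set \<Rightarrow> ('p \<Rightarrow> 'w set) \<Rightarrow> 'w set \<Rightarrow> 'p set" where
  "meets P X Y = {p\<in>P. Y \<inter> X p \<noteq> {}}"

(* The p below is determined by A, being the least element of meets P X A. *)
definition p_trim ::
  "'w topology \<Rightarrow> 'p::order set \<Rightarrow> ('p \<Rightarrow> 'w set) \<Rightarrow> 'p \<Rightarrow> 'w set \<Rightarrow> bool" where
  "p_trim W P X p A \<longleftrightarrow>
     p \<in> P \<and> compactin W A \<and> openin W A \<and> meets P X A = {q\<in>P. p \<le> q}"

definition trim :: "'w topology \<Rightarrow> 'p::order set \<Rightarrow> ('p \<Rightarrow> 'w set) \<Rightarrow> 'w set \<Rightarrow> bool" where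
  "trim W P X A \<longleftrightarrow> (\<exists>p\<in>P. p_trim W P X p A)"

definition trim_hat :: "'w topology \<Rightarrow> 'p::order set \<Rightarrow> ('p \<Rightarrow> 'w set) \<Rightarrow> 'p set" where
  "trim_hat W P X = {p\<in>P. \<exists>A. p_trim W P X p A}"

(* The set of all t(A), for A a trim set containing w. *)
definition trim_types_at ::
  "'w topology \<Rightarrow> 'p::order set \<Rightarrow> ('p \<Rightarrow> 'w set) \<Rightarrow> 'w \<Rightarrow> 'p set" where
  "trim_types_at W P X w = {p. \<exists>A. p_trim W P X p A \<and> w \<in> A}"

definition semi_trim :: "'w topology \<Rightarrow> 'p::order set \<Rightarrow> ('p \<Rightarrow> 'w set) \<Rightarrow> bool" where
  "semi_trim W P X \<longleftrightarrow>
     poset_partition W P X \<and>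
     (\<forall>w\<in>topspace W. neighbourhood_base_at w (trim W P X) W) \<and>
     (\<forall>A p. openin W A \<and> p \<in> meets P X A \<inter> trim_hat W P X \<longrightarrow>
        (\<exists>B. B \<subseteq> A \<and> p_trim W P X p B)) \<and>
     (\<forall>p\<in>P. \<forall>x\<in>X p. isLub P (trim_types_at W P X x) p) \<and>
     (\<forall>p\<in>P. \<forall>w\<in>topspace W. neighbourhood_base_at w (p_trim W P X p) W \<longrightarrow> w \<in> X p)"

definition clean_points ::
  "'w topology \<Rightarrow> 'p::order set \<Rightarrow> ('p \<Rightarrow> 'w set) \<Rightarrow> 'p \<Rightarrow> 'w set" where
  "clean_points W P X p = {w \<in> X p. \<exists>A. p_trim W P X p A \<and> w \<in> A}"

definition trim_partition :: "'w topology \<Rightarrow> 'p::order set \<Rightarrow> ('p \<Rightarrow> 'w set) \<Rightarrow> bool" where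
  "trim_partition W P X \<longleftrightarrow> semi_trim W P X \<and> (\<forall>p\<in>P. \<forall>w\<in>X p. w \<in> clean_points W P X p)"

(* The clean interior of a semi-trim P-partition X is the family clean_points W P X,
   indexed by the poset trim_hat W P X. *)

section \<open>Chain completion\<close>

(* Markowsky's chain completion of P, realised by lower sets of P that are closed under the
   suprema of chains that exist in P, ordered by inclusion: it is the least collection of
   such sets that contains the principal ideals and is closed under suprema of (non-empty)
   chains, where the supremum of a chain of closed sets is the closure of its union.
   P is embedded by down P. *)

definition down :: "'p::order set \<Rightarrow> 'p \<Rightarrow> 'p set" where
  "down P p = {x\<in>P. x \<le> p}"

definition chain_closed :: "'p::order set \<Rightarrow> 'p set \<Rightarrow> bool" where
  "chain_closed P D \<longleftrightarrow>
     D \<subseteq> P \<and> (\<forall>x\<in>D. down P x \<subseteq> D) \<and>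
     (\<forall>C s. C \<subseteq> D \<and> C \<noteq> {} \<and> Complete_Partial_Order.chain (\<le>) C \<and> isLub P C s \<longrightarrow> s \<in> D)"

inductive_set chain_completion :: "'p::order set \<Rightarrow> 'p set set" for P where
  principal: "p \<in> P \<Longrightarrow> down P p \<in> chain_completion P"
| chain_sup: "\<lbrakk>\<forall>A\<in>C. A \<in> chain_completion P; C \<noteq> {}; Complete_Partial_Order.chain (\<subseteq>) C\<rbrakk>
     \<Longrightarrow> chain_closed P hull (\<Union>C) \<in> chain_completion P"

(* The poset consisting of P and the suprema, in the chain completion of P, of the
   ascending sequences in Q. *)
definition chain_completion_rel :: "'p::order set \<Rightarrow> 'p set \<Rightarrow> 'p set set" where
  "chain_completion_rel P Q =
     down P ` P \<union>
     {r. \<exists>q::nat \<Rightarrow> 'p. incseq q \<and> range q \<subseteq> Q \<and> isLub (chain_completion P) (down P ` range q) r}"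

(* The completion of a semi-trim P-partition X is the family trim_completion W P X, indexed by
   the poset completion_index W P X. It need not be semi-trim for every semi-trim X: let
   P consist of two strictly ascending sequences d, e and an element p, where d k <= e n
   iff k <= n, and d k <= p for all k, but p is incomparable to all e n. Then p is the
   supremum of d in P, so p lies below the new supremum r of e, although p is below no e n,
   and there is a trim P-partition with a p-trim set that contains no point of type r.
   Statements that need a semi-trim completion therefore have to assume it. *)

definition completion_index :: "'w topology \<Rightarrow> 'p::order set \<Rightarrow> ('p \<Rightarrow> 'w set) \<Rightarrow> 'p set set" where
  "completion_index W P X = chain_completion_rel P (trim_hat W P X)"

definition trim_completion ::
  "'w topology \<Rightarrow> 'p::order set \<Rightarrow> ('p \<Rightarrow> 'w set) \<Rightarrow> 'p set \<Rightarrow> 'w set" where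
  "trim_completion W P X r =
     {w \<in> topspace W. isLub (completion_index W P X) (down P ` trim_types_at W P X w) r}"

(* Q is chain-unique over its sub-poset P. *)
definition chain_unique :: "'p::order set \<Rightarrow> 'p set \<Rightarrow> bool" where
  "chain_unique Q P \<longleftrightarrow>
     P \<subseteq> Q \<and>
     (\<forall>(p::nat \<Rightarrow> 'p) q r. incseq p \<and> range p \<subseteq> P \<and> isLub Q (range p) q \<and> r \<in> P \<and> r < q
        \<longrightarrow> (\<exists>n. r \<le> p n))"

definition partition_refines ::
  "'p set \<Rightarrow> ('p \<Rightarrow> 'w set) \<Rightarrow> 'r set \<Rightarrow> ('r \<Rightarrow> 'w set) \<Rightarrow> bool" where
  "partition_refines P X R Y \<longleftrightarrow> (\<forall>p\<in>P. \<exists>r\<in>R. X p \<subseteq> Y r)"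

end

theory Submission
  imports Defs
begin

text \<open>
  Part (i): since \<open>X p\<close> lies in the member of the completion indexed by \<open>down P p\<close>, a trim set for
  one partition that is contained in a trim set for the other and shares a suitable point with it
  must have the same type, so both partitions have the same types and the same clean points.

  Part (ii): a set is \<open>p\<close>-trim for a semi-trim partition iff it is \<open>p\<close>-trim for its clean interior.
  By first countability the types of the trim sets around a point \<open>w\<close> of \<open>Y q\<close> have a cofinal
  ascending sequence, with supremum \<open>q\<close>. By chain-uniqueness every chain-closed set
  containing this sequence contains all \<open>h \<le> q\<close> in \<open>trim_hat W Q Y\<close>; so the supremum
  of the sequence in the chain completion depends only on \<open>q\<close>.
\<close>

section \<open>Second countability of the Stone space of a countable Boolean ring\<close>

lemma boolean_ring_prime_ideal_mult:
  fixes a b :: "'r::boolean_ring"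
  assumes "prime_ideal I"
  shows "a * b \<notin> I \<longleftrightarrow> a \<notin> I \<and> b \<notin> I"
  using assms unfolding prime_ideal_def by blast

text \<open>The subbasic sets \<open>D a\<close> are indexed by the countable ring, and
  \<open>D a \<inter> D b = D (a * b)\<close>. So they already form a basis.\<close>

lemma second_countable_stone_space:
  "second_countable (stone_space :: 'r::{boolean_ring,countable} set topology)"
proof -
  define D :: "'r \<Rightarrow> 'r set set" where "D a = {I. prime_ideal I \<and> a \<notin> I}" for a
  have stone: "(stone_space :: 'r set topology) = topology_generated_by (range D)"
    unfolding stone_space_def D_def by (simp add: full_SetCompr_eq)
  have base: "\<exists>a. x \<in> D a \<and> D a \<subseteq> U"
    if "generate_topology_on (range D) U" "x \<in> U" for U x
    using that
  proof (induction arbitrary: x)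
    case (Int U V)
    then obtain a b where "x \<in> D a" "D a \<subseteq> U" "x \<in> D b" "D b \<subseteq> V"
      by blast
    then have "x \<in> D (a * b)" "D (a * b) \<subseteq> U \<inter> V"
      using boolean_ring_prime_ideal_mult unfolding D_def by blast+
    then show ?case by blast
  next
    case (UN K)
    then show ?case by (meson Union_iff Sup_upper subset_trans)
  qed auto
  have "openin stone_space (D a)" for a
    unfolding stone by (simp add: openin_topology_generated_by_iff generate_topology_on.Basis)
  moreover have "\<exists>V\<in>range D. x \<in> V \<and> V \<subseteq> U" if "openin stone_space U" "x \<in> U" for U x
    using base[of U x] that unfolding stone openin_topology_generated_by_iff by auto
  ultimately show ?thesis
    unfolding second_countable_def by (intro exI[of _ "range D"]) auto
qed

section \<open>Elementary facts on suprema, trim sets and semi-trim partitions\<close>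

lemma isLub_iff:
  "isLub P S x \<longleftrightarrow> x \<in> P \<and> (\<forall>y\<in>S. y \<le> x) \<and> (\<forall>z\<in>P. (\<forall>y\<in>S. y \<le> z) \<longrightarrow> x \<le> z)"
  by (auto simp: isLub_def leastP_def isUb_def setle_def setge_def)

lemma p_trimD:
  assumes "p_trim W P X p A"
  shows p_trim_index: "p \<in> P"
    and p_trim_openin: "openin W A"
    and p_trim_compactin: "compactin W A"
    and p_trim_meets_iff: "q \<in> P \<Longrightarrow> A \<inter> X q \<noteq> {} \<longleftrightarrow> p \<le> q"
  using assms unfolding p_trim_def meets_def by blast+

lemma p_trim_point:
  assumes "p_trim W P X p A"
  obtains x where "x \<in> A" "x \<in> X p"
  using p_trim_meets_iff[OF assms p_trim_index[OF assms]] by auto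

lemma p_trimI:
  assumes "p \<in> P" "compactin W A" "openin W A" "\<And>q. q \<in> P \<Longrightarrow> A \<inter> X q \<noteq> {} \<longleftrightarrow> p \<le> q"
  shows "p_trim W P X p A"
  using assms unfolding p_trim_def meets_def by blast

text \<open>A point of \<open>X q\<close> in \<open>B\<close> also lies in \<open>A\<close>, so
  \<open>q\<close> belongs to the up-set of \<open>p\<close>. Types therefore grow as trim sets
  shrink.\<close>

lemma p_trim_antimono:
  assumes "p_trim W P X p A" "p_trim W P X q B" "B \<subseteq> A"
  shows "p \<le> q"
  using p_trim_meets_iff[OF assms(1) p_trim_index[OF assms(2)]] p_trim_point[OF assms(2)] assms(3)
  by blast

lemma trim_types_at_subset: "trim_types_at W P X w \<subseteq> trim_hat W P X"
  unfolding trim_types_at_def trim_hat_def using p_trim_index by blast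

lemma trim_hat_subset: "trim_hat W P X \<subseteq> P"
  unfolding trim_hat_def by blast

lemma semi_trim_nhd:
  assumes "semi_trim W P X" "openin W U" "w \<in> U"
  obtains A p where "p_trim W P X p A" "w \<in> A" "A \<subseteq> U"
proof -
  have "w \<in> topspace W"
    using assms openin_subset by blast
  then have "neighbourhood_base_at w (trim W P X) W"
    using assms(1) unfolding semi_trim_def by blast
  then obtain V A where "trim W P X A" "w \<in> V" "V \<subseteq> A" "A \<subseteq> U"
    using assms(2,3) unfolding neighbourhood_base_at_def by blast
  then show thesis
    using that unfolding trim_def by blast
qed

lemma semi_trim_isLub:
  assumes "semi_trim W P X" "p \<in> P" "x \<in> X p"
  shows "isLub P (trim_types_at W P X x) p"
  using assms unfolding semi_trim_def by blast

lemma semi_trim_shrink: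
  assumes "semi_trim W P X" "openin W A" "p \<in> trim_hat W P X" "x \<in> A" "x \<in> X p"
  obtains B where "B \<subseteq> A" "p_trim W P X p B"
  using assms trim_hat_subset[of W P X] unfolding semi_trim_def meets_def by blast

lemma semi_trim_nonempty:
  assumes "semi_trim W P X" "p \<in> P"
  shows "X p \<noteq> {}" "X p \<subseteq> topspace W"
  using assms unfolding semi_trim_def poset_partition_def by blast+

text \<open>Near \<open>w\<close> every trim set has the single type \<open>p\<close>, so the trim
  neighbourhood base at \<open>w\<close> yields a base of \<open>p\<close>-trim sets, and the last
  axiom of semi-trimness applies.\<close>

lemma semi_trim_mem:
  assumes "semi_trim W P X" "p \<in> P" "openin W U" "w \<in> U"
    and "\<And>A q. p_trim W P X q A \<Longrightarrow> w \<in> A \<Longrightarrow> A \<subseteq> U \<Longrightarrow> q = p"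
  shows "w \<in> X p"
proof -
  have "neighbourhood_base_at w (p_trim W P X p) W"
    unfolding neighbourhood_base_at_def
  proof (intro allI impI)
    fix V assume "openin W V \<and> w \<in> V"
    with assms(3,4) have "openin W (U \<inter> V)" "w \<in> U \<inter> V"
      by auto
    with assms(1) obtain A q where "p_trim W P X q A" "w \<in> A" "A \<subseteq> U \<inter> V"
      by (rule semi_trim_nhd)
    with assms(5) show "\<exists>U A. openin W U \<and> p_trim W P X p A \<and> w \<in> U \<and> U \<subseteq> A \<and> A \<subseteq> V"
      using p_trim_openin by (metis le_inf_iff subset_refl)
  qed
  moreover have "w \<in> topspace W"
    using assms(3,4) openin_subset by blast
  ultimately show ?thesis
    using assms(1,2) unfolding semi_trim_def by blast
qed

section \<open>Part (i): the clean interior of the completion of a trim partition\<close>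

lemma down_subset_iff: "p \<in> P \<Longrightarrow> down P p \<subseteq> down P q \<longleftrightarrow> p \<le> q"
  by (auto simp: down_def)

context
  fixes W :: "'w topology" and P :: "'p::order set" and X :: "'p \<Rightarrow> 'w set"
  assumes trim: "trim_partition W P X"
    and semi: "semi_trim W (completion_index W P X) (trim_completion W P X)"
begin

lemma trim_partition_nhd:
  assumes "p \<in> P" "x \<in> X p"
  obtains A where "p_trim W P X p A" "x \<in> A"
  using trim assms unfolding trim_partition_def clean_points_def by blast

lemma trim_partition_semi_trim: "semi_trim W P X"
  using trim unfolding trim_partition_def by blast

lemma down_in_completion_index: "p \<in> P \<Longrightarrow> down P p \<in> completion_index W P X"
  unfolding completion_index_def chain_completion_rel_def by blast

lemma trim_completion_ge:
  assumes "w \<in> trim_completion W P X r" "p_trim W P X p A" "w \<in> A"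
  shows "down P p \<subseteq> r"
  using assms unfolding trim_completion_def trim_types_at_def isLub_iff by blast

text \<open>As \<open>x\<close> is clean, \<open>p\<close> itself is a type at \<open>x\<close>. The
  supremum of the types is thus a maximum, and it stays one in the larger index poset.\<close>

lemma trim_completion_down:
  assumes "p \<in> P" "x \<in> X p"
  shows "x \<in> trim_completion W P X (down P p)"
proof -
  have lub: "isLub P (trim_types_at W P X x) p"
    using trim_partition_semi_trim assms by (rule semi_trim_isLub)
  have "p \<in> trim_types_at W P X x"
    using trim_partition_nhd[OF assms] unfolding trim_types_at_def by blast
  moreover have "down P q \<subseteq> down P p" if "q \<in> trim_types_at W P X x" for q
    using lub that order_trans unfolding isLub_iff down_def by blast
  ultimately show ?thesis
    using assms down_in_completion_index semi_trim_nonempty[OF trim_partition_semi_trim]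
    unfolding trim_completion_def isLub_iff by blast
qed

text \<open>A point of \<open>X p\<close> in \<open>A\<close> has index \<open>down P p\<close> in
  the completion, so \<open>B\<close> meets that member.\<close>

lemma trim_completion_p_trim_le:
  assumes "p_trim W (completion_index W P X) (trim_completion W P X) r B"
    and "p_trim W P X p A" "A \<subseteq> B"
  shows "r \<subseteq> down P p"
proof -
  obtain x where "x \<in> A" "x \<in> X p"
    using assms(2) by (rule p_trim_point)
  then show ?thesis
    using assms trim_completion_down p_trim_index[OF assms(2)] p_trim_meets_iff[OF assms(1)]
      down_in_completion_index by blast
qed

text \<open>A point of index \<open>r\<close> in an \<open>r\<close>-trim set \<open>B\<close> has
  an \<open>X\<close>-trim neighbourhood inside \<open>B\<close>. Its type is bounded from both
  sides by \<open>r\<close>, so \<open>r\<close> is principal: a supremum outside the image of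
  \<open>P\<close> is never the type of a trim set.\<close>

lemma trim_hat_trim_completion:
  "trim_hat W (completion_index W P X) (trim_completion W P X) \<subseteq> down P ` P"
proof
  fix r assume "r \<in> trim_hat W (completion_index W P X) (trim_completion W P X)"
  then obtain B where B: "p_trim W (completion_index W P X) (trim_completion W P X) r B"
    unfolding trim_hat_def by blast
  then obtain w where w: "w \<in> B" "w \<in> trim_completion W P X r"
    by (rule p_trim_point)
  obtain A p where A: "p_trim W P X p A" "w \<in> A" "A \<subseteq> B"
    using trim_partition_semi_trim p_trim_openin[OF B] w(1) by (rule semi_trim_nhd)
  have "r = down P p"
    using trim_completion_p_trim_le[OF B A(1,3)] trim_completion_ge[OF w(2) A(1,2)] by blast
  then show "r \<in> down P ` P"
    using p_trim_index[OF A(1)] by blast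
qed

lemma clean_points_trim_completion:
  assumes "p \<in> P"
  shows "clean_points W (completion_index W P X) (trim_completion W P X) (down P p) = X p"
proof (intro subset_antisym subsetI)
  fix x assume x: "x \<in> X p"
  have xc: "x \<in> trim_completion W P X (down P p)"
    using assms x by (rule trim_completion_down)
  obtain A where A: "p_trim W P X p A" "x \<in> A"
    using assms x by (rule trim_partition_nhd)
  \<comment> \<open>The roles of the two partitions are exchanged: semi-trimness of the completion
    shrinks \<open>A\<close> to one of its own trim sets. A point of index \<open>r\<close> in
    \<open>B\<close> lies in \<open>A\<close>, and \<open>x\<close> of index \<open>down P p\<close>
    lies in \<open>B\<close>; this gives the two inclusions.\<close>
  obtain B r where B: "p_trim W (completion_index W P X) (trim_completion W P X) r B" "x \<in> B" "B \<subseteq> A"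
    using semi p_trim_openin[OF A(1)] A(2) by (rule semi_trim_nhd)
  obtain w where w: "w \<in> B" "w \<in> trim_completion W P X r"
    using B(1) by (rule p_trim_point)
  have "down P p \<subseteq> r"
    using trim_completion_ge[OF w(2) A(1)] w(1) B(3) by blast
  moreover have "r \<subseteq> down P p"
    using p_trim_meets_iff[OF B(1) down_in_completion_index[OF assms]] B(2) xc by blast
  ultimately have "r = down P p"
    by blast
  with B xc show "x \<in> clean_points W (completion_index W P X) (trim_completion W P X) (down P p)"
    unfolding clean_points_def by blast
next
  fix w assume "w \<in> clean_points W (completion_index W P X) (trim_completion W P X) (down P p)"
  then obtain B where w: "w \<in> trim_completion W P X (down P p)" "w \<in> B"
    and B: "p_trim W (completion_index W P X) (trim_completion W P X) (down P p) B"
    unfolding clean_points_def by blast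
  \<comment> \<open>One inclusion uses that \<open>A\<close> lies in \<open>B\<close>, the other
    that \<open>w\<close> has index \<open>down P p\<close>.\<close>
  have "q = p" if "p_trim W P X q A" "w \<in> A" "A \<subseteq> B" for A q
    using trim_completion_p_trim_le[OF B that(1,3)] trim_completion_ge[OF w(1) that(1,2)]
      down_subset_iff assms p_trim_index[OF that(1)] by (metis order_antisym)
  with trim_partition_semi_trim assms p_trim_openin[OF B] w(2) show "w \<in> X p"
    by (rule semi_trim_mem)
qed

lemma trim_hat_trim_completion_eq:
  "trim_hat W (completion_index W P X) (trim_completion W P X) = down P ` P"
proof -
  \<comment> \<open>Since \<open>X p\<close> is non-empty and consists of clean points of the
    completion, one of them supplies a trim set of type \<open>down P p\<close>.\<close>
  have "down P p \<in> trim_hat W (completion_index W P X) (trim_completion W P X)" if "p \<in> P" for p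
    using clean_points_trim_completion[OF that] down_in_completion_index[OF that]
      semi_trim_nonempty(1)[OF trim_partition_semi_trim that]
    unfolding clean_points_def trim_hat_def by blast
  with trim_hat_trim_completion show ?thesis
    by blast
qed

end

section \<open>Cofinal sequences of types at a point, and trim sets of the clean interior\<close>

lemma semi_trim_types_cofinal_sequence:
  assumes "semi_trim W P X" "first_countable W" "w \<in> topspace W"
  obtains s :: "nat \<Rightarrow> 'p::order" where "incseq s" "range s \<subseteq> trim_types_at W P X w"
    "\<And>p. p \<in> trim_types_at W P X w \<Longrightarrow> \<exists>n. p \<le> s n"
proof -
  obtain \<B> where \<B>: "countable \<B>" "\<And>V. V \<in> \<B> \<Longrightarrow> openin W V"
    "\<And>U. openin W U \<Longrightarrow> w \<in> U \<Longrightarrow> \<exists>V\<in>\<B>. w \<in> V \<and> V \<subseteq> U"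
    using assms(2,3) unfolding first_countable_def by metis
  define \<N> where "\<N> = {V\<in>\<B>. w \<in> V}"
  have "countable \<N>" "\<N> \<noteq> {}"
    using \<B>(1) \<B>(3)[OF openin_topspace assms(3)] by (auto simp: \<N>_def)
  \<comment> \<open>The enumeration may repeat members, which also covers a finite \<N>.\<close>
  then obtain f :: "nat \<Rightarrow> 'a set" where f: "range f = \<N>"
    by (metis range_from_nat_into)
  have fn: "openin W (f n)" "w \<in> f n" for n
    using f \<B>(2) unfolding \<N>_def by blast+
  \<comment> \<open>Each choice is a pair of a type and a trim set around \<open>w\<close>. The sets
    descend through the neighbourhood base, so the types ascend and are cofinal.\<close>
  let ?T = "\<lambda>a. p_trim W P X (fst a) (snd a) \<and> w \<in> snd a"
  have "\<exists>a. \<forall>n. ?T (a n) \<and> snd (a (Suc n)) \<subseteq> snd (a n) \<inter> f n"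
  proof (rule dependent_nat_choice)
    show "\<exists>a. ?T a"
      using semi_trim_nhd[OF assms(1) openin_topspace assms(3)] by (metis fst_conv snd_conv)
    fix a n assume a: "?T a"
    then have "openin W (snd a \<inter> f n)" "w \<in> snd a \<inter> f n"
      using fn p_trim_openin by blast+
    with assms(1) obtain A p where "p_trim W P X p A" "w \<in> A" "A \<subseteq> snd a \<inter> f n"
      by (rule semi_trim_nhd)
    then show "\<exists>b. ?T b \<and> snd b \<subseteq> snd a \<inter> f n"
      by (intro exI[of _ "(p, A)"]) simp
  qed
  then obtain a where a: "\<And>n. ?T (a n)" "\<And>n. snd (a (Suc n)) \<subseteq> snd (a n) \<inter> f n"
    by blast
  show thesis
  proof (rule that)
    show "incseq (fst \<circ> a)"
    proof (rule incseq_SucI)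
      fix n
      show "(fst \<circ> a) n \<le> (fst \<circ> a) (Suc n)"
        using p_trim_antimono[of W P X "fst (a n)" "snd (a n)"] a(1)[of n] a(1)[of "Suc n"] a(2)[of n]
        by auto
    qed
    show "range (fst \<circ> a) \<subseteq> trim_types_at W P X w"
      using a(1) unfolding trim_types_at_def by auto
    fix p assume "p \<in> trim_types_at W P X w"
    then obtain A where A: "p_trim W P X p A" "w \<in> A"
      unfolding trim_types_at_def by blast
    with \<B>(3)[OF p_trim_openin[OF A(1)]] have "\<exists>V\<in>range f. V \<subseteq> A"
      unfolding f \<N>_def by blast
    then obtain n where "f n \<subseteq> A"
      by blast
    \<comment> \<open>The index is \<open>Suc n\<close> because the set chosen after stage
      \<open>n\<close> is the one that lies inside \<open>f n\<close>.\<close>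
    with a(2)[of n] have "snd (a (Suc n)) \<subseteq> A"
      by blast
    with A(1) a(1) have "p \<le> (fst \<circ> a) (Suc n)"
      unfolding comp_apply using p_trim_antimono by blast
    then show "\<exists>n. p \<le> (fst \<circ> a) n" ..
  qed
qed

text \<open>Discarding unclean points loses no trim sets: whenever an open set meets
  \<open>Y q\<close> with \<open>q\<close> in \<open>?H\<close>, it contains a \<open>q\<close>-trim
  set, and the points of \<open>Y q\<close> in that set are clean.\<close>

lemma p_trim_clean_interior_iff:
  assumes "semi_trim W Q Y"
  shows "p_trim W (trim_hat W Q Y) (clean_points W Q Y) p A \<longleftrightarrow> p_trim W Q Y p A"
    (is "p_trim W ?H ?Z p A \<longleftrightarrow> _")
proof
  assume A: "p_trim W Q Y p A"
  show "p_trim W ?H ?Z p A"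
  proof (rule p_trimI)
    show "p \<in> ?H" "compactin W A" "openin W A"
      using p_trimD[OF A] A unfolding trim_hat_def by blast+
    fix q assume q: "q \<in> ?H"
    then have "q \<in> Q"
      using trim_hat_subset by blast
    note meets = p_trim_meets_iff[OF A this]
    show "A \<inter> ?Z q \<noteq> {} \<longleftrightarrow> p \<le> q"
    proof
      show "p \<le> q" if "A \<inter> ?Z q \<noteq> {}"
        using meets that unfolding clean_points_def by blast
      assume "p \<le> q"
      then obtain x where "x \<in> A" "x \<in> Y q"
        using meets by blast
      with assms p_trim_openin[OF A] q obtain B where "B \<subseteq> A" "p_trim W Q Y q B"
        by (rule semi_trim_shrink)
      then show "A \<inter> ?Z q \<noteq> {}"
        using p_trim_point unfolding clean_points_def by blast
    qed
  qed
next
  assume A: "p_trim W ?H ?Z p A"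
  show "p_trim W Q Y p A"
  proof (rule p_trimI)
    show "p \<in> Q" "compactin W A" "openin W A"
      using p_trimD[OF A] trim_hat_subset by blast+
    fix q assume q: "q \<in> Q"
    show "A \<inter> Y q \<noteq> {} \<longleftrightarrow> p \<le> q"
    proof
      assume "A \<inter> Y q \<noteq> {}"
      then obtain w where w: "w \<in> A" "w \<in> Y q"
        by blast
      \<comment> \<open>As \<open>q\<close> may lie outside \<open>?H\<close>, the comparison with
        \<open>p\<close> passes through the type \<open>r\<close> of a small trim set around
        \<open>w\<close>.\<close>
      obtain B r where B: "p_trim W Q Y r B" "w \<in> B" "B \<subseteq> A"
        using assms p_trim_openin[OF A] w(1) by (rule semi_trim_nhd)
      obtain x where "x \<in> B" "x \<in> Y r"
        using B(1) by (rule p_trim_point)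
      with B have "x \<in> A \<inter> ?Z r" "r \<in> ?H"
        using p_trim_index[OF B(1)] unfolding clean_points_def trim_hat_def by blast+
      then have "p \<le> r"
        using p_trim_meets_iff[OF A] by blast
      also have "r \<le> q"
        using p_trim_meets_iff[OF B(1) q] B(2) w(2) by blast
      finally show "p \<le> q" .
    next
      assume "p \<le> q"
      obtain x where x: "x \<in> A" "x \<in> ?Z p"
        using A by (rule p_trim_point)
      then have "x \<in> Y p"
        unfolding clean_points_def by blast
      \<comment> \<open>The set \<open>B\<close> obtained here need not contain \<open>x\<close>; it
        matters that, being \<open>p\<close>-trim for \<open>Y\<close>, it meets \<open>Y q\<close>
        for all \<open>q\<close> in \<open>Q\<close> above \<open>p\<close>.\<close>
      with assms p_trim_openin[OF A] p_trim_index[OF A] x(1)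
      obtain B where "B \<subseteq> A" "p_trim W Q Y p B"
        by (rule semi_trim_shrink)
      then show "A \<inter> Y q \<noteq> {}"
        using p_trim_meets_iff[OF _ q] \<open>p \<le> q\<close> by blast
    qed
  qed
qed

lemma trim_types_at_clean_interior:
  assumes "semi_trim W Q Y"
  shows "trim_types_at W (trim_hat W Q Y) (clean_points W Q Y) w = trim_types_at W Q Y w"
  unfolding trim_types_at_def p_trim_clean_interior_iff[OF assms] ..

text \<open>With this, the completion of the clean interior is indexed by
  \<open>chain_completion_rel\<close> with both arguments equal to
  \<open>trim_hat W Q Y\<close>.\<close>

lemma trim_hat_clean_interior:
  assumes "semi_trim W Q Y"
  shows "trim_hat W (trim_hat W Q Y) (clean_points W Q Y) = trim_hat W Q Y"
  unfolding trim_hat_def[of W "trim_hat W Q Y"] p_trim_clean_interior_iff[OF assms]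
  by (auto simp: trim_hat_def)

section \<open>Chain-closed sets and the chain completion\<close>

lemma chain_closed_lub:
  assumes "chain_closed P D" "C \<subseteq> D" "C \<noteq> {}" "Complete_Partial_Order.chain (\<le>) C" "isLub P C s"
  shows "s \<in> D"
  using assms unfolding chain_closed_def by blast

lemma chain_closed_down_subset: "chain_closed P D \<Longrightarrow> x \<in> D \<Longrightarrow> down P x \<subseteq> D"
  unfolding chain_closed_def by blast

lemma chain_closed_Inter:
  assumes "\<And>D. D \<in> \<D> \<Longrightarrow> chain_closed P D" "\<D> \<noteq> {}"
  shows "chain_closed P (\<Inter>\<D>)"
  unfolding chain_closed_def
proof (intro conjI ballI allI impI)
  show "\<Inter>\<D> \<subseteq> P"
    using assms unfolding chain_closed_def by blast
  show "down P x \<subseteq> \<Inter>\<D>" if "x \<in> \<Inter>\<D>" for x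
    using that assms(1) chain_closed_down_subset by blast
  show "s \<in> \<Inter>\<D>"
    if "C \<subseteq> \<Inter>\<D> \<and> C \<noteq> {} \<and> Complete_Partial_Order.chain (\<le>) C \<and> isLub P C s" for C s
    using that assms(1) chain_closed_lub by (metis InterI Inter_lower subset_trans)
qed

lemma chain_closed_self: "chain_closed P P"
  unfolding chain_closed_def isLub_iff down_def by auto

text \<open>The inclusion in \<open>P\<close> makes \<open>P\<close> itself a member of the
  intersected family; an empty intersection would be \<open>UNIV\<close>.\<close>

lemma chain_closed_hull: "U \<subseteq> P \<Longrightarrow> chain_closed P (chain_closed P hull U)"
  unfolding hull_def using chain_closed_self by (intro chain_closed_Inter) auto

lemma chain_closed_down: "p \<in> P \<Longrightarrow> chain_closed P (down P p)"
  unfolding chain_closed_def isLub_iff down_def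
  by (intro conjI ballI allI impI) (auto intro: order_trans)

lemma chain_completion_chain_closed: "A \<in> chain_completion P \<Longrightarrow> chain_closed P A"
proof (induction rule: chain_completion.induct)
  case (chain_sup C)
  then have "\<Union>C \<subseteq> P"
    unfolding chain_closed_def by blast
  then show ?case by (rule chain_closed_hull)
qed (rule chain_closed_down)

text \<open>Lets the minimality of a hull be tested against every upper bound in the index
  poset.\<close>

lemma chain_completion_rel_chain_closed:
  "r \<in> chain_completion_rel P Q \<Longrightarrow> chain_closed P r"
  unfolding chain_completion_rel_def
  by (auto dest: isLubD1a intro: chain_closed_down chain_completion_chain_closed)

section \<open>Chain-uniqueness and suprema of ascending sequences\<close>

lemma incseq_chain: "incseq s \<Longrightarrow> Complete_Partial_Order.chain (\<le>) (range s)"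
  unfolding chain_def incseq_def using nat_le_linear by blast

text \<open>An \<open>h\<close> strictly below \<open>q\<close> lies below some \<open>s n\<close>
  by chain-uniqueness, and \<open>D\<close> is a lower set. If \<open>h = q\<close>, then
  \<open>q\<close> lies in \<open>H\<close> and is the supremum of \<open>s\<close> there too, so
  closure under suprema of chains applies.\<close>

lemma chain_unique_chain_closed_subset:
  assumes "chain_unique Q H" "chain_closed H D"
    and "incseq s" "range s \<subseteq> D" "isLub Q (range s) q"
  shows "{h\<in>H. h \<le> q} \<subseteq> D"
proof clarify
  fix h assume h: "h \<in> H" "h \<le> q"
  have HQ: "H \<subseteq> Q" "D \<subseteq> H"
    using assms(1,2) unfolding chain_unique_def chain_closed_def by blast+
  show "h \<in> D"
  proof (cases "h = q")
    case True
    then have "isLub H (range s) h"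
      using assms(5) h(1) HQ(1) unfolding isLub_iff by blast
    with assms(2,4) incseq_chain[OF assms(3)] show ?thesis
      by (intro chain_closed_lub[of H D "range s"]) auto
  next
    case False
    with h assms(1,3,4,5) HQ(2) obtain n where "h \<le> s n"
      unfolding chain_unique_def by (metis order_less_le subset_trans)
    then show ?thesis
      using chain_closed_down_subset[OF assms(2)] assms(4) h(1) unfolding down_def by blast
  qed
qed

text \<open>The supremum depends on \<open>q\<close> alone, not on \<open>S\<close>: every
  chain-closed upper bound contains \<open>s\<close>, hence all of \<open>H\<close> below
  \<open>q\<close>. The hull is taken because \<open>q\<close> may lie outside \<open>H\<close>, and
  then a supremum in \<open>H\<close> of elements below \<open>q\<close> need not be below
  \<open>q\<close>. The poset \<open>R\<close> is left general to cover both the chain completion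
  and the index poset of the completed partition.\<close>

lemma chain_unique_hull_isLub:
  assumes "chain_unique Q H" "incseq s" "range s \<subseteq> S" "S \<subseteq> H"
    and "isLub Q (range s) q" "isLub Q S q"
    and "R \<subseteq> Collect (chain_closed H)" "chain_closed H hull {h\<in>H. h \<le> q} \<in> R"
  shows "isLub R (down H ` S) (chain_closed H hull {h\<in>H. h \<le> q})"
proof -
  have "down H p \<subseteq> chain_closed H hull {h\<in>H. h \<le> q}" if "p \<in> S" for p
  proof -
    have "down H p \<subseteq> {h\<in>H. h \<le> q}"
      using that assms(6) order_trans unfolding isLub_iff down_def by blast
    also have "\<dots> \<subseteq> chain_closed H hull {h\<in>H. h \<le> q}"
      by (rule hull_subset)
    finally show ?thesis .
  qed
  moreover have "chain_closed H hull {h\<in>H. h \<le> q} \<subseteq> D"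
    if "D \<in> R" "\<And>p. p \<in> S \<Longrightarrow> down H p \<subseteq> D" for D
  proof (rule hull_minimal)
    show D: "chain_closed H D"
      using that(1) assms(7) by blast
    have "range s \<subseteq> D"
      using that(2) assms(3,4) unfolding down_def by blast
    with assms(1) D assms(2) show "{h\<in>H. h \<le> q} \<subseteq> D"
      using assms(5) by (rule chain_unique_chain_closed_subset)
  qed
  ultimately show ?thesis
    using assms(8) unfolding isLub_iff by blast
qed

text \<open>The ideals \<open>down H (s n)\<close> form a chain, whose supremum in the completion is
  the hull of their union. That hull is chain-closed and contains \<open>s\<close>, so it contains
  all of \<open>H\<close> below \<open>q\<close>.\<close>

lemma chain_unique_hull_in_chain_completion:
  assumes "chain_unique Q H" "incseq s" "range s \<subseteq> H" "isLub Q (range s) q"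
  shows "chain_closed H hull {h\<in>H. h \<le> q} \<in> chain_completion H"
proof -
  let ?C = "down H ` range s"
  have C: "\<Union>?C \<subseteq> {h\<in>H. h \<le> q}"
    using assms(4) order_trans unfolding isLub_iff down_def by blast
  have "Complete_Partial_Order.chain (\<subseteq>) ?C"
    using incseq_chain[OF assms(2)] by (rule chain_imageI) (auto simp: down_def)
  then have "chain_closed H hull \<Union>?C \<in> chain_completion H"
    using assms(3) by (intro chain_completion.chain_sup) (auto intro: chain_completion.principal)
  moreover have "chain_closed H hull \<Union>?C = chain_closed H hull {h\<in>H. h \<le> q}"
  proof
    show "chain_closed H hull \<Union>?C \<subseteq> chain_closed H hull {h\<in>H. h \<le> q}"
      using C by (rule hull_mono)
    have closed: "chain_closed H (chain_closed H hull \<Union>?C)"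
      using C by (intro chain_closed_hull) blast
    have "range s \<subseteq> \<Union>?C"
      using assms(3) unfolding down_def by blast
    also have "\<Union>?C \<subseteq> chain_closed H hull \<Union>?C"
      by (rule hull_subset)
    finally have "{h\<in>H. h \<le> q} \<subseteq> chain_closed H hull \<Union>?C"
      using chain_unique_chain_closed_subset[OF assms(1) closed assms(2)] assms(4) by blast
    then show "chain_closed H hull {h\<in>H. h \<le> q} \<subseteq> chain_closed H hull \<Union>?C"
      using closed by (rule hull_minimal)
  qed
  ultimately show ?thesis
    by simp
qed

lemma semi_trim_refines_completion_of_clean_interior:
  assumes semi: "semi_trim W Q Y" and unique: "chain_unique Q (trim_hat W Q Y)"
    and "first_countable W"
  shows "partition_refines Q Y
    (completion_index W (trim_hat W Q Y) (clean_points W Q Y))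
    (trim_completion W (trim_hat W Q Y) (clean_points W Q Y))"
  unfolding partition_refines_def
proof
  fix q assume q: "q \<in> Q"
  let ?H = "trim_hat W Q Y"
  let ?R = "completion_index W ?H (clean_points W Q Y)"
  let ?r = "chain_closed ?H hull {h\<in>?H. h \<le> q}"
  have R: "?R = chain_completion_rel ?H ?H"
    unfolding completion_index_def trim_hat_clean_interior[OF semi] ..
  have sequence: "\<exists>s. incseq s \<and> range s \<subseteq> trim_types_at W Q Y w \<and> isLub Q (range s) q"
    if "w \<in> Y q" for w
  proof -
    have "w \<in> topspace W"
      using semi_trim_nonempty(2)[OF semi q] that by blast
    with semi assms(3) obtain s where s: "incseq s" "range s \<subseteq> trim_types_at W Q Y w"
      "\<And>p. p \<in> trim_types_at W Q Y w \<Longrightarrow> \<exists>n. p \<le> s n"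
      by (rule semi_trim_types_cofinal_sequence) blast
    \<comment> \<open>By cofinality \<open>range s\<close> has the same upper bounds as the set of
      all types at \<open>w\<close>, whose supremum is \<open>q\<close> by semi-trimness.\<close>
    have "isLub Q (range s) q"
      using semi_trim_isLub[OF semi q that] s(2,3) unfolding isLub_iff
      by (meson order_trans rangeI subsetD)
    with s show ?thesis
      by blast
  qed
  \<comment> \<open>Any single point of the non-empty \<open>Y q\<close> provides a witnessing
    sequence; \<open>?r\<close> does not depend on this choice.\<close>
  have r: "?r \<in> ?R"
  proof -
    obtain w where "w \<in> Y q"
      using semi_trim_nonempty(1)[OF semi q] by blast
    with sequence obtain s where s: "incseq s" "range s \<subseteq> ?H" "isLub Q (range s) q"
      using trim_types_at_subset by (metis subset_trans)
    have "isLub (chain_completion ?H) (down ?H ` range s) ?r"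
      using chain_unique_hull_isLub[OF unique s(1) subset_refl s(2,3,3)]
        chain_unique_hull_in_chain_completion[OF unique s] chain_completion_chain_closed
      by blast
    with s show ?thesis
      unfolding R chain_completion_rel_def by blast
  qed
  have "w \<in> trim_completion W ?H (clean_points W Q Y) ?r" if w: "w \<in> Y q" for w
  proof -
    obtain s where s: "incseq s" "range s \<subseteq> trim_types_at W Q Y w" "isLub Q (range s) q"
      using sequence[OF w] by blast
    \<comment> \<open>Here \<open>S\<close> is the full set of types at \<open>w\<close>, and the
      supremum is taken in the index poset rather than in the whole chain completion.\<close>
    have "isLub ?R (down ?H ` trim_types_at W Q Y w) ?r"
      using unique s(1,2) trim_types_at_subset s(3) semi_trim_isLub[OF semi q w] _ r
      by (rule chain_unique_hull_isLub) (auto simp: R dest: chain_completion_rel_chain_closed)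
    then show ?thesis
      using w semi_trim_nonempty(2)[OF semi q]
      unfolding trim_completion_def trim_types_at_clean_interior[OF semi] by blast
  qed
  with r show "\<exists>r\<in>?R. Y q \<subseteq> trim_completion W ?H (clean_points W Q Y) r"
    by blast
qed

theorem theorem4p14:
  fixes W :: "'w topology"
    and P :: "'p::order set" and X :: "'p \<Rightarrow> 'w set"
    and Q :: "'q::order set" and Y :: "'q \<Rightarrow> 'w set"
  assumes "W homeomorphic_space (stone_space :: 'r::{boolean_ring,countable} set topology)"
  shows "(trim_partition W P X \<and>
            semi_trim W (completion_index W P X) (trim_completion W P X) \<longrightarrow>
          trim_hat W (completion_index W P X) (trim_completion W P X) = down P ` P \<and>
          (\<forall>p\<in>P. clean_points W (completion_index W P X) (trim_completion W P X) (down P p) = X p))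
       \<and> (semi_trim W Q Y \<and> complete_partition W Q Y \<and> chain_unique Q (trim_hat W Q Y) \<longrightarrow>
          partition_refines Q Y
            (completion_index W (trim_hat W Q Y) (clean_points W Q Y))
            (trim_completion W (trim_hat W Q Y) (clean_points W Q Y)))"
proof (intro conjI impI)
  assume "trim_partition W P X \<and> semi_trim W (completion_index W P X) (trim_completion W P X)"
  then have X: "trim_partition W P X" "semi_trim W (completion_index W P X) (trim_completion W P X)"
    by auto
  show "trim_hat W (completion_index W P X) (trim_completion W P X) = down P ` P"
    using X by (rule trim_hat_trim_completion_eq)
  show "\<forall>p\<in>P. clean_points W (completion_index W P X) (trim_completion W P X) (down P p) = X p"
    using clean_points_trim_completion[OF X] ..
next
  assume "semi_trim W Q Y \<and> complete_partition W Q Y \<and> chain_unique Q (trim_hat W Q Y)"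
  then have Y: "semi_trim W Q Y" "chain_unique Q (trim_hat W Q Y)"
    by auto
  \<comment> \<open>Countability of the ring enters here: second countability passes from the Stone
    space to \<open>W\<close> along the homeomorphism.\<close>
  have "first_countable W"
    using assms second_countable_stone_space homeomorphic_space_second_countability
      second_countable_imp_first_countable by blast
  with Y show "partition_refines Q Y
      (completion_index W (trim_hat W Q Y) (clean_points W Q Y))
      (trim_completion W (trim_hat W Q Y) (clean_points W Q Y))"
    by (rule semi_trim_refines_completion_of_clean_interior)
qed

end
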